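(* Let $E$ be a complex separable Banach space of M-type 2 and let $A$ be a densely defined, closed linear operator in $E$ which is sectorial, i.e. there are $\varpi\in(0,\frac{\pi}{2})$ and $M_\varpi>0$ such that $\sigma(A)\subset\Sigma_\varpi=\{\lambda\in\mathbb C:|\arg\lambda|<\varpi\}$ and $\|(\lambda-A)^{-1}\|\le M_\varpi/|\lambda|$ for all $\lambda\notin\Sigma_\varpi$. Consider the linear stochastic Cauchy problem $$dX+AX\,dt=F_1(t)\,dt+G(t)\,dW(t),\quad 0<t\le T,\qquad X(0)=\xi .$$ If there exists a strict solution to this problem on $[0,T]$, then it is unique.
   Context: Setting. $E$ (norm $\|\cdot\|$) is of M-type 2: there is a constant $c(E)$ such that $\sup_n\mathbb E\|M_n\|^2\le c(E)\sum_{n\ge0}\mathbb E\|M_n-M_{n-1}\|^2$ for all $E$-valued martingales $(M_n)_n$ (with $M_{-1}=0$). $H$ is a separable Hilbert space, and $W$ is a cylindrical Wiener process on $H$ defined on a complete filtered probability space $(\Omega,\mathcal F,\mathcal F_t,\mathbb P)$. $\gamma(H;E)$ is the Banach space of $\gamma$-radonifying operators $\phi:H\to E$ (bounded operators such that $\sum_n\gamma_n\phi e_n$ converges in $L^2(\Omega',E)$, for an orthonormal basis $(e_n)$ of $H$ and i.i.d. standard Gaussians $(\gamma_n)$ on a probability space $\Omega'$), with norm $\|\phi\|_{\gamma(H;E)}=(\mathbb E'\|\sum_n\gamma_n\phi e_n\|^2)^{1/2}$. $\mathcal I^2([0,T])$ is the class of adapted, $H$-strongly measurable processes $\phi:[0,T]\times\Omega\to\gamma(H;E)$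 belonging to $L^2((0,T)\times\Omega;\gamma(H;E))$ ($H$-strongly measurable: $\phi(\cdot)h$ is strongly measurable for every $h\in H$); for such $\phi$ the stochastic integral $\int_0^t\phi\,dW$ is defined as the limit of integrals of adapted step processes. Data: $F_1:[0,T]\times\Omega\to E$ is measurable with respect to the predictable $\sigma$-field on $[0,T]\times\Omega$, $G\in\mathcal I^2([0,T])$, and $\xi$ is an $E$-valued $\mathcal F_0$-measurable random variable. A strict solution on $[0,T]$ is an adapted $E$-valued continuous process $X$ on $[0,T]$ such that, a.s. for $0<t\le T$, $X(t)\in\mathcal D(A)$, $\|\int_0^tAX(s)ds\|<\infty$, and $$X(t)=\xi-\int_0^tAX(s)ds+\int_0^tF_1(s)ds+\int_0^tG(s)dW(s).$$ A strict solution $X$ is unique if any other strict solution $\bar X$ on $[0,T]$ is indistinguishable from it, i.e. $\mathbb P\{X(t)=\bar X(t)\text{ for every }t\in[0,T]\}=1$. *)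

theory Defs
  imports "HOL-Probability.Probability"
begin

section \<open>Complex Banach spaces\<close>

text \<open>
  Separability is expressed by the additional sort \<open>second_countable_topology\<close>, as in the
  library's theory of the Bochner integral.
\<close>

class complex_banach = banach +
  fixes scaleC :: "complex \<Rightarrow> 'a \<Rightarrow> 'a" (infixr "*\<^sub>C" 75)
  assumes scaleC_add_right: "a *\<^sub>C (x + y) = a *\<^sub>C x + a *\<^sub>C y"
    and scaleC_add_left: "(a + b) *\<^sub>C x = a *\<^sub>C x + b *\<^sub>C x"
    and scaleC_scaleC: "a *\<^sub>C (b *\<^sub>C x) = (a * b) *\<^sub>C x"
    and scaleC_complex_of_real: "complex_of_real r *\<^sub>C x = r *\<^sub>R x"
    and norm_scaleC: "norm (a *\<^sub>C x) = cmod a * norm x"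


section \<open>M-type 2\<close>

definition banach_martingale ::
  "'w measure \<Rightarrow> (nat \<Rightarrow> 'w measure) \<Rightarrow> (nat \<Rightarrow> 'w \<Rightarrow> 'e::{banach,second_countable_topology}) \<Rightarrow> bool"
where
  "banach_martingale P \<G> N \<longleftrightarrow>
     (\<forall>n. subalgebra P (\<G> n)) \<and>
     (\<forall>n. sets (\<G> n) \<subseteq> sets (\<G> (Suc n))) \<and>
     (\<forall>n. N n \<in> borel_measurable (\<G> n)) \<and>
     (\<forall>n. integrable P (N n)) \<and>
     (\<forall>n. \<forall>B\<in>sets (\<G> n). (LINT \<omega>:B|P. N (Suc n) \<omega>) = (LINT \<omega>:B|P. N n \<omega>))"

text \<open>
  A predicate cannot quantify over the type of the sample points. The type \<open>nat \<Rightarrow> 'e\<close> loses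
  nothing: an \<open>'e\<close>-valued martingale on any probability space has the same norms in mean as the
  coordinate process under its law on the sequence space, which is a martingale for its natural
  filtration.
\<close>

definition M_type_2 :: "'e::{banach,second_countable_topology} itself \<Rightarrow> bool" where
  "M_type_2 _ \<longleftrightarrow>
     (\<exists>c::real. \<forall>(P :: (nat \<Rightarrow> 'e) measure) \<G> (N :: nat \<Rightarrow> (nat \<Rightarrow> 'e) \<Rightarrow> 'e).
        prob_space P \<longrightarrow> banach_martingale P \<G> N \<longrightarrow>
        (SUP n. \<integral>\<^sup>+\<omega>. ennreal ((norm (N n \<omega>))\<^sup>2) \<partial>P)
          \<le> ennreal c *
             (\<Sum>n. \<integral>\<^sup>+\<omega>. ennreal ((norm (N n \<omega> - (if n = 0 then 0 else N (n - 1) \<omega>)))\<^sup>2) \<partial>P))"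


section \<open>Unbounded operators\<close>

text \<open>
  An operator is a pair of a domain \<open>D\<close> and a total function \<open>A\<close>, whose values outside \<open>D\<close> are
  irrelevant.
\<close>

definition linear_operator_on :: "'e::complex_banach set \<Rightarrow> ('e \<Rightarrow> 'e) \<Rightarrow> bool" where
  "linear_operator_on D A \<longleftrightarrow>
     0 \<in> D \<and>
     (\<forall>x\<in>D. \<forall>y\<in>D. x + y \<in> D \<and> A (x + y) = A x + A y) \<and>
     (\<forall>a. \<forall>x\<in>D. a *\<^sub>C x \<in> D \<and> A (a *\<^sub>C x) = a *\<^sub>C A x)"

definition closed_operator :: "'e::complex_banach set \<Rightarrow> ('e \<Rightarrow> 'e) \<Rightarrow> bool" where
  "closed_operator D A \<longleftrightarrow> closed {(x, A x) | x. x \<in> D}"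

definition densely_defined :: "'e::complex_banach set \<Rightarrow> bool" where
  "densely_defined D \<longleftrightarrow> closure D = UNIV"

definition resolvent :: "'e::complex_banach set \<Rightarrow> ('e \<Rightarrow> 'e) \<Rightarrow> complex \<Rightarrow> 'e \<Rightarrow> 'e" where
  "resolvent D A z = inv_into D (\<lambda>x. z *\<^sub>C x - A x)"

definition resolvent_set :: "'e::complex_banach set \<Rightarrow> ('e \<Rightarrow> 'e) \<Rightarrow> complex set" where
  "resolvent_set D A =
     {z. bij_betw (\<lambda>x. z *\<^sub>C x - A x) D UNIV \<and> bounded_linear (resolvent D A z)}"

definition spectrum :: "'e::complex_banach set \<Rightarrow> ('e \<Rightarrow> 'e) \<Rightarrow> complex set" where
  "spectrum D A = - resolvent_set D A"

text \<open>
  The origin has no argument and does not belong to the sector (the library sets \<open>Arg 0 = 0\<close>).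
\<close>

definition sector :: "real \<Rightarrow> complex set" where
  "sector \<theta> = {z. z \<noteq> 0 \<and> \<bar>Arg z\<bar> < \<theta>}"

text \<open>
  At \<open>z = 0\<close> the bound \<open>C / \<bar>z\<bar>\<close> is infinite, hence void; with \<open>C / 0 = 0\<close> it would force the
  inverse of \<open>A\<close> to vanish. That \<open>0\<close> lies in the resolvent set is part of the spectral inclusion.
\<close>

definition sectorial :: "'e::complex_banach set \<Rightarrow> ('e \<Rightarrow> 'e) \<Rightarrow> bool" where
  "sectorial D A \<longleftrightarrow>
     (\<exists>\<theta> C. 0 < \<theta> \<and> \<theta> < pi / 2 \<and> 0 < C \<and>
        spectrum D A \<subseteq> sector \<theta> \<and>
        (\<forall>z. z \<notin> sector \<theta> \<longrightarrow> z \<noteq> 0 \<longrightarrow> onorm (resolvent D A z) \<le> C / cmod z))"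


section \<open>Radonifying operators\<close>

text \<open>
  An orthonormal basis of a separable Hilbert space, indexed by the natural numbers and padded with
  zero vectors when the space has finite dimension.
\<close>

definition orthonormal_basis_seq :: "(nat \<Rightarrow> 'h::real_inner) \<Rightarrow> bool" where
  "orthonormal_basis_seq e \<longleftrightarrow>
     (\<forall>i j. i \<noteq> j \<longrightarrow> inner (e i) (e j) = 0) \<and>
     (\<forall>i. e i = 0 \<or> norm (e i) = 1) \<and>
     closure (span (range e)) = UNIV"

text \<open>
  Neither the class of radonifying operators nor the norm depends on the basis or on the Gaussian
  sequence, so both are fixed once and for all.
\<close>

definition hilbert_basis :: "nat \<Rightarrow> 'h::{real_inner,complete_space,second_countable_topology}" where
  "hilbert_basis = (SOME e. orthonormal_basis_seq e)"

definition gauss_space :: "(nat \<Rightarrow> real) measure" where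
  "gauss_space = (\<Pi>\<^sub>M i\<in>UNIV. density lborel (\<lambda>x. ennreal (std_normal_density x)))"

definition gamma_series ::
  "('h::{real_inner,complete_space,second_countable_topology}
      \<Rightarrow>\<^sub>L 'e::{banach,second_countable_topology}) \<Rightarrow> ((nat \<Rightarrow> real) \<Rightarrow> 'e) \<Rightarrow> bool"
where
  "gamma_series \<phi> S \<longleftrightarrow>
     S \<in> borel_measurable gauss_space \<and>
     (\<lambda>n. \<integral>\<^sup>+x. ennreal ((norm ((\<Sum>i<n. x i *\<^sub>R blinfun_apply \<phi> (hilbert_basis i)) - S x))\<^sup>2)
        \<partial>gauss_space) \<longlonglongrightarrow> 0"

definition gamma_radonifying ::
  "('h::{real_inner,complete_space,second_countable_topology}
      \<Rightarrow>\<^sub>L 'e::{banach,second_countable_topology}) \<Rightarrow> bool"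
where
  "gamma_radonifying \<phi> \<longleftrightarrow> (\<exists>S. gamma_series \<phi> S)"

definition gamma_norm ::
  "('h::{real_inner,complete_space,second_countable_topology}
      \<Rightarrow>\<^sub>L 'e::{banach,second_countable_topology}) \<Rightarrow> real"
where
  "gamma_norm \<phi> = sqrt (\<integral>x. (norm ((SOME S. gamma_series \<phi> S) x))\<^sup>2 \<partial>gauss_space)"


section \<open>Filtrations and cylindrical Wiener processes\<close>

definition complete_filtered_prob_space :: "'w measure \<Rightarrow> (real \<Rightarrow> 'w measure) \<Rightarrow> bool" where
  "complete_filtered_prob_space M \<F> \<longleftrightarrow>
     prob_space M \<and> complete_measure M \<and>
     (\<forall>t\<ge>0. subalgebra M (\<F> t)) \<and>
     (\<forall>s t. 0 \<le> s \<longrightarrow> s \<le> t \<longrightarrow> sets (\<F> s) \<subseteq> sets (\<F> t)) \<and>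
     null_sets M \<subseteq> sets (\<F> 0)"

text \<open>
  For each \<open>t\<close> the map \<open>h \<mapsto> W t h\<close> is a linear map into square-integrable random variables;
  its boundedness is contained in the covariance formula. For each \<open>h\<close> the process \<open>W t h\<close> is a
  Brownian motion relative to \<open>\<F>\<close>, with variance \<open>t (norm h)\<^sup>2\<close>.
\<close>

definition cylindrical_Wiener_process ::
  "'w measure \<Rightarrow> (real \<Rightarrow> 'w measure)
     \<Rightarrow> (real \<Rightarrow> 'h::{real_inner,complete_space,second_countable_topology} \<Rightarrow> 'w \<Rightarrow> real) \<Rightarrow> bool"
where
  "cylindrical_Wiener_process M \<F> W \<longleftrightarrow>
     (\<forall>t\<ge>0. \<forall>h. W t h \<in> borel_measurable (\<F> t)) \<and>
     (\<forall>t\<ge>0. \<forall>a b g h. AE \<omega> in M. W t (a *\<^sub>R g + b *\<^sub>R h) \<omega> = a * W t g \<omega> + b * W t h \<omega>) \<and>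
     (\<forall>h. AE \<omega> in M. W 0 h \<omega> = 0) \<and>
     (\<forall>h. AE \<omega> in M. continuous_on {0..} (\<lambda>t. W t h \<omega>)) \<and>
     (\<forall>s t h. 0 \<le> s \<longrightarrow> s < t \<longrightarrow>
        prob_space.indep_set M (sets (\<F> s))
          {(\<lambda>\<omega>. W t h \<omega> - W s h \<omega>) -` B \<inter> space M | B. B \<in> sets borel}) \<and>
     (\<forall>s t h. 0 \<le> s \<longrightarrow> s < t \<longrightarrow> h \<noteq> 0 \<longrightarrow>
        distributed M lborel (\<lambda>\<omega>. W t h \<omega> - W s h \<omega>)
          (\<lambda>x. ennreal (normal_density 0 (sqrt (t - s) * norm h) x))) \<and>
     (\<forall>s t g h. 0 \<le> s \<longrightarrow> 0 \<le> t \<longrightarrow>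
        integrable M (\<lambda>\<omega>. W s g \<omega> * W t h \<omega>) \<and>
        (\<integral>\<omega>. W s g \<omega> * W t h \<omega> \<partial>M) = min s t * inner g h)"


section \<open>Stochastic integral\<close>

definition time_space :: "'w measure \<Rightarrow> real \<Rightarrow> (real \<times> 'w) measure" where
  "time_space M T = restrict_space lborel {0..T} \<Otimes>\<^sub>M M"

text \<open>
  In a separable metric space a map is strongly measurable iff its distance to every point is
  measurable; the condition on \<open>gamma_norm\<close> thus is strong measurability as a map into the
  (separable) space of radonifying operators.
\<close>

definition I2_process ::
  "'w measure \<Rightarrow> (real \<Rightarrow> 'w measure) \<Rightarrow> real
     \<Rightarrow> (real \<Rightarrow> 'w \<Rightarrow> ('h::{real_inner,complete_space,second_countable_topology}
            \<Rightarrow>\<^sub>L 'e::{banach,second_countable_topology})) \<Rightarrow> bool"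
where
  "I2_process M \<F> T \<phi> \<longleftrightarrow>
     (\<forall>t\<in>{0..T}. \<forall>\<omega>\<in>space M. gamma_radonifying (\<phi> t \<omega>)) \<and>
     (\<forall>t\<in>{0..T}. \<forall>h. (\<lambda>\<omega>. blinfun_apply (\<phi> t \<omega>) h) \<in> borel_measurable (\<F> t)) \<and>
     (\<forall>h. (\<lambda>(t, \<omega>). blinfun_apply (\<phi> t \<omega>) h) \<in> borel_measurable (time_space M T)) \<and>
     (\<forall>\<psi>. gamma_radonifying \<psi> \<longrightarrow>
        (\<lambda>(t, \<omega>). gamma_norm (\<phi> t \<omega> - \<psi>)) \<in> borel_measurable (time_space M T)) \<and>
     (\<integral>\<^sup>+(t, \<omega>). ennreal ((gamma_norm (\<phi> t \<omega>))\<^sup>2) \<partial>time_space M T) < \<infinity>"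

text \<open>
  An adapted step process is a finite sum of elementary processes
  \<open>1\<^bsub>(a,b]\<^esub>(t) 1\<^bsub>B\<^esub>(\<omega>) h \<otimes> x\<close> with \<open>B\<close> in \<open>\<F> a\<close>, where \<open>h \<otimes> x\<close> is the rank-one
  operator \<open>k \<mapsto> (h \<bullet> k) x\<close>. It is represented by the list of the tuples \<open>(a, b, B, h, x)\<close>.
\<close>

type_synonym ('w, 'h, 'e) step = "(real \<times> real \<times> 'w set \<times> 'h \<times> 'e) list"

definition adapted_step :: "(real \<Rightarrow> 'w measure) \<Rightarrow> real \<Rightarrow> ('w, 'h, 'e) step \<Rightarrow> bool" where
  "adapted_step \<F> T \<sigma> \<longleftrightarrow> (\<forall>(a, b, B, h, x)\<in>set \<sigma>. 0 \<le> a \<and> a < b \<and> b \<le> T \<and> B \<in> sets (\<F> a))"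

definition step_process ::
  "('w, 'h::real_inner, 'e::real_normed_vector) step \<Rightarrow> real \<Rightarrow> 'w \<Rightarrow> ('h \<Rightarrow>\<^sub>L 'e)"
where
  "step_process \<sigma> t \<omega> =
     (\<Sum>(a, b, B, h, x)\<leftarrow>\<sigma>. (indicator {a<..b} t * indicator B \<omega>) *\<^sub>R
        (blinfun_scaleR_left x o\<^sub>L blinfun_inner_right h))"

definition step_integral ::
  "(real \<Rightarrow> 'h \<Rightarrow> 'w \<Rightarrow> real) \<Rightarrow> ('w, 'h, 'e::real_normed_vector) step \<Rightarrow> real \<Rightarrow> 'w \<Rightarrow> 'e"
where
  "step_integral W \<sigma> t \<omega> =
     (\<Sum>(a, b, B, h, x)\<leftarrow>\<sigma>. (indicator B \<omega> * (W (min b t) h \<omega> - W (min a t) h \<omega>)) *\<^sub>R x)"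

definition is_stochastic_integral ::
  "'w measure \<Rightarrow> (real \<Rightarrow> 'w measure)
     \<Rightarrow> (real \<Rightarrow> 'h::{real_inner,complete_space,second_countable_topology} \<Rightarrow> 'w \<Rightarrow> real) \<Rightarrow> real
     \<Rightarrow> (real \<Rightarrow> 'w \<Rightarrow> ('h \<Rightarrow>\<^sub>L 'e::{banach,second_countable_topology}))
     \<Rightarrow> (real \<Rightarrow> 'w \<Rightarrow> 'e) \<Rightarrow> bool"
where
  "is_stochastic_integral M \<F> W T \<phi> I \<longleftrightarrow>
     (\<forall>t\<in>{0..T}. I t \<in> borel_measurable (\<F> t)) \<and>
     (AE \<omega> in M. continuous_on {0..T} (\<lambda>t. I t \<omega>)) \<and>
     (\<exists>\<sigma>. (\<forall>n. adapted_step \<F> T (\<sigma> n)) \<and>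
        (\<lambda>n. \<integral>\<^sup>+(t, \<omega>). ennreal ((gamma_norm (step_process (\<sigma> n) t \<omega> - \<phi> t \<omega>))\<^sup>2)
           \<partial>time_space M T) \<longlonglongrightarrow> 0 \<and>
        (\<forall>t\<in>{0..T}.
           (\<lambda>n. \<integral>\<^sup>+\<omega>. ennreal ((norm (step_integral W (\<sigma> n) t \<omega> - I t \<omega>))\<^sup>2) \<partial>M)
             \<longlonglongrightarrow> 0))"

text \<open>
  The limit determines the integral process up to indistinguishability; as usual, \<open>\<integral> \<phi> dW\<close>
  denotes a fixed continuous version.
\<close>

definition stochastic_integral ::
  "'w measure \<Rightarrow> (real \<Rightarrow> 'w measure)
     \<Rightarrow> (real \<Rightarrow> 'h::{real_inner,complete_space,second_countable_topology} \<Rightarrow> 'w \<Rightarrow> real) \<Rightarrow> real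
     \<Rightarrow> (real \<Rightarrow> 'w \<Rightarrow> ('h \<Rightarrow>\<^sub>L 'e::{banach,second_countable_topology}))
     \<Rightarrow> real \<Rightarrow> 'w \<Rightarrow> 'e"
where
  "stochastic_integral M \<F> W T \<phi> = (SOME I. is_stochastic_integral M \<F> W T \<phi> I)"

definition predictable_sigma :: "'w measure \<Rightarrow> (real \<Rightarrow> 'w measure) \<Rightarrow> real \<Rightarrow> (real \<times> 'w) measure" where
  "predictable_sigma M \<F> T =
     sigma ({0..T} \<times> space M)
       ({{s<..t} \<times> B | s t B. 0 \<le> s \<and> s < t \<and> t \<le> T \<and> B \<in> sets (\<F> s)} \<union>
        {{0} \<times> B | B. B \<in> sets (\<F> 0)})"


section \<open>Strict solutions\<close>

text \<open>
  Integrability of \<open>F1\<close> is what gives a meaning to its integral in the equation, since the library's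
  integral is \<open>0\<close> for functions that are not integrable.
\<close>

definition strict_solution ::
  "'w measure \<Rightarrow> (real \<Rightarrow> 'w measure)
     \<Rightarrow> (real \<Rightarrow> 'h::{real_inner,complete_space,second_countable_topology} \<Rightarrow> 'w \<Rightarrow> real) \<Rightarrow> real
     \<Rightarrow> 'e set \<Rightarrow> ('e \<Rightarrow> 'e) \<Rightarrow> (real \<Rightarrow> 'w \<Rightarrow> 'e)
     \<Rightarrow> (real \<Rightarrow> 'w \<Rightarrow> ('h \<Rightarrow>\<^sub>L 'e)) \<Rightarrow> ('w \<Rightarrow> 'e)
     \<Rightarrow> (real \<Rightarrow> 'w \<Rightarrow> 'e::{complex_banach,second_countable_topology}) \<Rightarrow> bool"
where
  "strict_solution M \<F> W T D A F1 G \<xi> X \<longleftrightarrow>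
     (\<forall>t\<in>{0..T}. X t \<in> borel_measurable (\<F> t)) \<and>
     (AE \<omega> in M. continuous_on {0..T} (\<lambda>t. X t \<omega>)) \<and>
     (AE \<omega> in M. \<forall>t\<in>{0<..T}.
        X t \<omega> \<in> D \<and>
        set_integrable lborel {0..t} (\<lambda>s. A (X s \<omega>)) \<and>
        set_integrable lborel {0..t} (\<lambda>s. F1 s \<omega>) \<and>
        X t \<omega> = \<xi> \<omega> - (LINT s:{0..t}|lborel. A (X s \<omega>)) + (LINT s:{0..t}|lborel. F1 s \<omega>)
                + stochastic_integral M \<F> W T G t \<omega>)"

definition indistinguishable ::
  "'w measure \<Rightarrow> real \<Rightarrow> (real \<Rightarrow> 'w \<Rightarrow> 'e) \<Rightarrow> (real \<Rightarrow> 'w \<Rightarrow> 'e) \<Rightarrow> bool"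
where
  "indistinguishable M T X Y \<longleftrightarrow> measure M {\<omega> \<in> space M. \<forall>t\<in>{0..T}. X t \<omega> = Y t \<omega>} = 1"

end

theory Submission
  imports Defs "HOL-Real_Asymp.Real_Asymp"
begin

text \<open>
  Both solutions have the same data, so their difference \<open>u\<close> satisfies, path by path,
  \<open>u(t) = - \<integral>\<^sub>0\<^sup>t A u(s) ds\<close>. Applying the bounded operator \<open>J = (-\<lambda> - A)\<^sup>-\<^sup>1\<close>
  with \<open>\<lambda> > 0\<close> turns this into the differential equation \<open>(J u)' = \<lambda> J u + u\<close> with initial value
  \<open>0\<close>, whence \<open>J u(T) = \<integral>\<^sub>0\<^sup>T exp (\<lambda> (T - s)) u(s) ds\<close>. Sectoriality bounds the left-hand side
  as \<open>\<lambda> \<rightarrow> \<infinity>\<close>, and a theorem of Phragmen says that a continuous \<open>u\<close> whose exponential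
  moments are bounded in this sense vanishes.
\<close>

section \<open>Two exponential series\<close>

lemma exp_sums_one_minus_exp_neg:
  fixes x :: real
  shows "(\<lambda>k. (-1) ^ k / fact (Suc k) * x ^ Suc k) sums (1 - exp (- x))"
proof -
  have "(\<lambda>k. (- x) ^ k /\<^sub>R fact k) sums exp (- x)"
    by (rule exp_converges)
  then have "(\<lambda>k. (- x) ^ Suc k /\<^sub>R fact (Suc k)) sums (exp (- x) - 1)"
    by (subst sums_Suc_iff) simp
  then have "(\<lambda>k. - ((- x) ^ Suc k /\<^sub>R fact (Suc k))) sums - (exp (- x) - 1)"
    by (rule sums_minus)
  moreover have "(\<lambda>k. - ((- x) ^ Suc k /\<^sub>R fact (Suc k))) = (\<lambda>k. (-1) ^ k / fact (Suc k) * x ^ Suc k)"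
    by (rule ext, subst power_minus) (simp add: divide_inverse del: fact_Suc)
  ultimately show ?thesis by simp
qed

text \<open>For \<open>x \<ge> 0\<close> these are the absolute values of the terms of the preceding
  series. They give the majorant for exchanging sum and integral, and their sum is the factor
  \<open>exp (exp (...)) - 1\<close> of \<open>phragmen_bound\<close>.\<close>

lemma exp_sums_exp_minus_one:
  fixes x :: real
  shows "(\<lambda>k. x ^ Suc k / fact (Suc k)) sums (exp x - 1)"
proof -
  have "(\<lambda>k. x ^ k /\<^sub>R fact k) sums exp x"
    by (rule exp_converges)
  then have "(\<lambda>k. x ^ Suc k /\<^sub>R fact (Suc k)) sums (exp x - 1)"
    by (subst sums_Suc_iff) simp
  then show ?thesis by (simp add: divide_inverse mult.commute del: fact_Suc)
qed

section \<open>Bochner integrals of continuous functions on a compact interval\<close>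

lemma continuous_on_interval_integrable_restrict:
  fixes f :: "real \<Rightarrow> 'a::{banach,second_countable_topology}"
  assumes "continuous_on {a..b} f"
  shows "integrable (restrict_space lborel {a..b}) f"
  using borel_integrable_atLeastAtMost'[OF assms]
  by (simp add: set_integrable_def integrable_restrict_space)

text \<open>This is the estimate behind the differentiability of the indefinite integral, with
  \<open>c\<close> the value of \<open>f\<close> at the point of differentiation. That point may be
  \<open>p\<close> or \<open>q\<close>, so right and left increments are both covered.\<close>

lemma norm_set_integral_increment_le:
  fixes f :: "real \<Rightarrow> 'a::{banach,second_countable_topology}"
  assumes f: "continuous_on {a..b} f" and pq: "a \<le> p" "p \<le> q" "q \<le> b"
    and e: "\<And>s. s \<in> {p..q} \<Longrightarrow> norm (f s - c) \<le> e"
  shows "norm ((LINT s:{a..q}|lborel. f s) - (LINT s:{a..p}|lborel. f s) - (q - p) *\<^sub>R c) \<le> e * (q - p)"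
proof -
  have int: "set_integrable lborel {x..y} f" if "a \<le> x" "y \<le> b" for x y
    by (intro borel_integrable_atLeastAtMost' continuous_on_subset[OF f]) (use that in auto)
  have int_pq: "set_integrable lborel {p<..q} f"
    by (rule set_integrable_subset[OF int[of p q]]) (use pq in auto)
  have const: "set_integrable lborel {p<..q} (\<lambda>s. c)"
    by (rule set_integrable_subset[of _ "{p..q}"]) (auto intro: borel_integrable_atLeastAtMost')
  have "{a..q} = {a..p} \<union> {p<..q}" using pq by auto
  then have "(LINT s:{a..q}|lborel. f s) = (LINT s:{a..p}|lborel. f s) + (LINT s:{p<..q}|lborel. f s)"
    using int[of a p] int_pq pq by (simp only:) (rule set_integral_Un, auto)
  moreover have "(LINT s:{p<..q}|lborel. c) = (q - p) *\<^sub>R c"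
    using pq by (simp add: set_lebesgue_integral_def)
  ultimately have "(LINT s:{a..q}|lborel. f s) - (LINT s:{a..p}|lborel. f s) - (q - p) *\<^sub>R c
      = (LINT s:{p<..q}|lborel. f s - c)"
    using set_integral_diff(2)[OF int_pq const] by simp
  also have "norm \<dots> \<le> (LINT s:{p<..q}|lborel. norm (f s - c))"
    by (intro set_integral_norm_bound set_integral_diff int_pq const)
  also have "\<dots> \<le> (LINT s:{p<..q}|lborel. e)"
  proof (rule set_integral_mono)
    show "set_integrable lborel {p<..q} (\<lambda>s. norm (f s - c))"
      by (intro set_integrable_norm set_integral_diff int_pq const)
    show "set_integrable lborel {p<..q} (\<lambda>s. e)"
      by (rule set_integrable_subset[of _ "{p..q}"]) (auto intro: borel_integrable_atLeastAtMost')
  qed (auto intro: e)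
  also have "\<dots> = e * (q - p)"
    using pq by (simp add: set_lebesgue_integral_def)
  finally show ?thesis .
qed

text \<open>The library relates the Bochner and the gauge integral for Euclidean ranges only.\<close>

lemma set_borel_integral_eq_integral_continuous:
  fixes f :: "real \<Rightarrow> 'a::{banach,second_countable_topology}"
  assumes f: "continuous_on {a..b} f" and ab: "a \<le> b"
  shows "(LINT s:{a..b}|lborel. f s) = integral {a..b} f"
proof -
  let ?F = "\<lambda>x. LINT s:{a..x}|lborel. f s"
  \<comment> \<open>The indefinite Bochner integral is a primitive of \<open>f\<close>; the
    fundamental theorem of calculus then identifies its increment with the gauge integral.\<close>
  have "(?F has_vector_derivative f x) (at x within {a..b})" if x: "x \<in> {a..b}" for x
    unfolding has_vector_derivative_def has_derivative_within_alt
  proof (intro conjI bounded_linear_scaleR_left allI impI)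
    fix e :: real assume "0 < e"
    with f x obtain d where d: "0 < d" "\<And>s. s \<in> {a..b} \<Longrightarrow> dist s x < d \<Longrightarrow> dist (f s) (f x) < e"
      unfolding continuous_on_iff by metis
    have close: "norm (f s - f x) \<le> e" if "s \<in> {a..b}" "\<bar>s - x\<bar> < d" for s
      using d(2)[of s] that by (simp add: dist_norm less_imp_le)
    have "norm (?F y - ?F x - (y - x) *\<^sub>R f x) \<le> e * norm (y - x)"
      if y: "y \<in> {a..b}" "norm (y - x) < d" for y
    proof (cases "x \<le> y")
      case True
      then show ?thesis
        using norm_set_integral_increment_le[OF f, of x y "f x" e] x y close by auto
    next
      case False
      then have "norm (?F x - ?F y - (x - y) *\<^sub>R f x) \<le> e * (x - y)"
        using norm_set_integral_increment_le[OF f, of y x "f x" e] x y close by auto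
      moreover have "?F y - ?F x - (y - x) *\<^sub>R f x = - (?F x - ?F y - (x - y) *\<^sub>R f x)"
        by (simp add: algebra_simps)
      ultimately show ?thesis
        using False by (simp only: norm_minus_cancel) simp
    qed
    with d(1) show "\<exists>d>0. \<forall>y\<in>{a..b}. norm (y - x) < d \<longrightarrow>
        norm (?F y - ?F x - (y - x) *\<^sub>R f x) \<le> e * norm (y - x)" by blast
  qed
  from fundamental_theorem_of_calculus[OF ab this]
  have "(f has_integral ?F b - ?F a) {a..b}" .
  moreover have "?F a = 0"
    unfolding set_lebesgue_integral_def
    by (intro integral_eq_zero_AE eventually_mono[OF AE_lborel_singleton[of a]]) (simp add: indicator_def)
  ultimately show ?thesis by (simp add: integral_unique)
qed

lemma integral_restrict_eq_integral:
  fixes f :: "real \<Rightarrow> 'a::{banach,second_countable_topology}"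
  assumes "continuous_on {a..b} f" "a \<le> b"
  shows "(LINT s|restrict_space lborel {a..b}. f s) = integral {a..b} f"
  using set_borel_integral_eq_integral_continuous[OF assms]
  by (simp add: set_lebesgue_integral_def integral_restrict_space)

section \<open>Phragmen's theorem on exponential moments\<close>

text \<open>
  Expanding \<open>1 - exp (- x)\<close> in powers of \<open>x = exp (n (r - s))\<close> writes the integral as a
  combination of exponential moments; as \<open>n \<rightarrow> \<infinity>\<close> the kernel tends to the indicator of \<open>s < r\<close>.
\<close>

lemma phragmen_bound:
  fixes u :: "real \<Rightarrow> 'a::{banach,second_countable_topology}"
  assumes u: "continuous_on {0..T} u" and r: "r < T"
    and T: "0 \<le> T"
    and K: "\<And>m::nat. 0 < m \<Longrightarrow> norm (integral {0..T} (\<lambda>s. exp (m * (T - s)) *\<^sub>R u s)) \<le> K"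
    and n: "0 < (n::nat)"
  shows "norm (LINT s|restrict_space lborel {0..T}. (1 - exp (- exp (n * (r - s)))) *\<^sub>R u s)
    \<le> K * (exp (exp (- n * (T - r))) - 1)"
proof -
  let ?M = "restrict_space lborel {0..T}"
  define g where "g = (\<lambda>k s. ((-1) ^ k / fact (Suc k) * exp (n * (r - s)) ^ Suc k) *\<^sub>R u s)"
  have gcont: "continuous_on {0..T} (g k)" for k
    unfolding g_def by (intro continuous_intros u)
  have gint: "integrable ?M (g k)" for k
    using gcont by (rule continuous_on_interval_integrable_restrict)
  \<comment> \<open>A bound for \<open>exp (n * (r - s))\<close> that is uniform in
    \<open>s \<in> {0..T}\<close>, whatever the sign of \<open>r\<close>.\<close>
  let ?q = "exp (n * \<bar>r\<bar> + n * \<bar>T\<bar>) :: real"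
  have normg: "norm (g k s) = exp (n * (r - s)) ^ Suc k / fact (Suc k) * norm (u s)" for k s
    by (simp add: g_def abs_mult power_abs del: fact_Suc power_Suc)
  have gsums: "(\<lambda>k. g k s) sums ((1 - exp (- exp (n * (r - s)))) *\<^sub>R u s)" for s
    unfolding g_def
    by (intro bounded_linear.sums[OF bounded_linear_scaleR_left] exp_sums_one_minus_exp_neg)
  have gsumm: "summable (\<lambda>k. norm (g k s))" for s
    unfolding normg
    by (intro summable_mult2 sums_summable[OF exp_sums_exp_minus_one])
  have int_norm_le: "(LINT s|?M. norm (g k s)) \<le> (LINT s|?M. norm (u s)) * (?q ^ Suc k / fact (Suc k))" for k
  proof -
    have "(LINT s|?M. norm (g k s)) \<le> (LINT s|?M. ?q ^ Suc k / fact (Suc k) * norm (u s))"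
    proof (rule integral_mono)
      show "integrable ?M (\<lambda>s. norm (g k s))" using gint by (rule integrable_norm)
      show "integrable ?M (\<lambda>s. ?q ^ Suc k / fact (Suc k) * norm (u s))"
        by (intro integrable_mult_right integrable_norm continuous_on_interval_integrable_restrict u)
      fix s assume s: "s \<in> space ?M"
      have "n * (r - s) \<le> n * \<bar>r\<bar> + n * \<bar>T\<bar>"
        unfolding distrib_left[symmetric] using s by (intro mult_left_mono) auto
      then show "norm (g k s) \<le> ?q ^ Suc k / fact (Suc k) * norm (u s)"
        unfolding normg
        by (intro mult_right_mono divide_right_mono power_mono) auto
    qed
    then show ?thesis by (simp add: mult.commute del: fact_Suc power_Suc)
  qed
  have summ_int: "summable (\<lambda>k. LINT s|?M. norm (g k s))"
  proof (rule summable_comparison_test')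
    show "summable (\<lambda>k. (LINT s|?M. norm (u s)) * (?q ^ Suc k / fact (Suc k)))"
      by (intro summable_mult sums_summable[OF exp_sums_exp_minus_one])
    show "norm (LINT s|?M. norm (g k s)) \<le> (LINT s|?M. norm (u s)) * (?q ^ Suc k / fact (Suc k))"
      if "0 \<le> k" for k
      using int_norm_le[of k] by simp
  qed
  have "(\<lambda>k. LINT s|?M. g k s) sums (LINT s|?M. (\<Sum>k. g k s))"
    by (rule sums_integral[OF gint _ summ_int]) (simp add: gsumm)
  then have sums: "(\<lambda>k. LINT s|?M. g k s) sums (LINT s|?M. (1 - exp (- exp (n * (r - s)))) *\<^sub>R u s)"
    using gsums by (simp add: sums_iff)
  \<comment> \<open>Splitting \<open>r - s = (T - s) - (T - r)\<close> turns the \<open>k\<close>-th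
    term into the moment of order \<open>m = n * Suc k\<close> times \<open>?p ^ Suc k\<close>. The
    expansion of \<open>1 - exp (- x)\<close> has no constant term, so every order is positive and
    \<open>K\<close> applies.\<close>
  let ?p = "exp (- n * (T - r)) :: real"
  have term_le: "norm (LINT s|?M. g k s) \<le> K * (?p ^ Suc k / fact (Suc k))" for k
  proof -
    have "exp (n * (r - s)) ^ Suc k = ?p ^ Suc k * exp (real (n * Suc k) * (T - s))" for s
      by (subst (1 2) exp_of_nat_mult[symmetric], subst exp_add[symmetric])
        (simp add: algebra_simps)
    then have "g k = (\<lambda>s. ((-1) ^ k / fact (Suc k) * ?p ^ Suc k) *\<^sub>R
        (exp (real (n * Suc k) * (T - s)) *\<^sub>R u s))"
      by (simp add: g_def mult.assoc del: fact_Suc power_Suc of_nat_mult)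
    then have "(LINT s|?M. g k s) = ((-1) ^ k / fact (Suc k) * ?p ^ Suc k) *\<^sub>R
        integral {0..T} (\<lambda>s. exp (real (n * Suc k) * (T - s)) *\<^sub>R u s)"
      using integral_restrict_eq_integral[OF gcont T, of k] by (simp only: integral_cmul)
    then have "norm (LINT s|?M. g k s) = ?p ^ Suc k / fact (Suc k) *
        norm (integral {0..T} (\<lambda>s. exp (real (n * Suc k) * (T - s)) *\<^sub>R u s))"
      by (simp add: abs_mult power_abs del: fact_Suc power_Suc of_nat_mult)
    also have "\<dots> \<le> ?p ^ Suc k / fact (Suc k) * K"
      using n by (intro mult_left_mono K) auto
    finally show ?thesis by (simp add: mult.commute)
  qed
  have psums: "(\<lambda>k. K * (?p ^ Suc k / fact (Suc k))) sums (K * (exp ?p - 1))"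
    by (intro sums_mult exp_sums_exp_minus_one)
  show ?thesis
    using sums_unique[OF sums] sums_unique[OF psums]
      norm_suminf_le[OF term_le sums_summable[OF psums]] by simp
qed

text \<open>The smoothed integrals tend to \<open>0\<close> by \<open>phragmen_bound\<close> and to
  the integral of \<open>u\<close> over \<open>{0..r}\<close> by dominated convergence. Hence the
  indefinite integral of \<open>u\<close> vanishes, and so does its derivative
  \<open>u\<close>.\<close>

lemma phragmen:
  fixes u :: "real \<Rightarrow> 'a::{banach,second_countable_topology}"
  assumes T: "0 < T" and u: "continuous_on {0..T} u"
    and K: "\<And>m::nat. 0 < m \<Longrightarrow> norm (integral {0..T} (\<lambda>s. exp (m * (T - s)) *\<^sub>R u s)) \<le> K"
    and t: "t \<in> {0..T}"
  shows "u t = 0"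
proof -
  let ?M = "restrict_space lborel {0..T}"
  have zero: "integral {0..r} u = 0" if r: "r \<in> {0<..<T}" for r
  proof -
    let ?I = "\<lambda>n::nat. LINT s|?M. (1 - exp (- exp (n * (r - s)))) *\<^sub>R u s"
    have "?I \<longlonglongrightarrow> (LINT s|?M. indicator {..r} s *\<^sub>R u s)"
    proof (rule integral_dominated_convergence[where w = "\<lambda>s. norm (u s)"])
      show "(\<lambda>s. indicator {..r} s *\<^sub>R u s) \<in> borel_measurable ?M"
        using borel_measurable_integrable[OF continuous_on_interval_integrable_restrict[OF u]]
        by (intro borel_measurable_scaleR[OF measurable_restrict_space1]) auto
      show "(\<lambda>s. (1 - exp (- exp (real n * (r - s)))) *\<^sub>R u s) \<in> borel_measurable ?M" for n
        by (intro borel_measurable_integrable continuous_on_interval_integrable_restrict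
            continuous_intros u)
      show "integrable ?M (\<lambda>s. norm (u s))"
        by (intro integrable_norm continuous_on_interval_integrable_restrict u)
      \<comment> \<open>At \<open>s = r\<close> the kernel is constantly
        \<open>1 - exp (- 1)\<close>, which is not the value of the indicator; this single point is
        a null set.\<close>
      have lim: "(\<lambda>n. (1 - exp (- exp (real n * (r - s)))) *\<^sub>R u s) \<longlonglongrightarrow> indicator {..r} s *\<^sub>R u s"
        if "s \<noteq> r" for s
      proof (cases "s < r")
        case True
        then have "(\<lambda>n. 1 - exp (- exp (real n * (r - s)))) \<longlonglongrightarrow> 1" by real_asymp
        with True show ?thesis by (intro tendsto_scaleR tendsto_const) simp_all
      next
        case False
        with that have "r - s < 0" by simp
        then have "(\<lambda>n. 1 - exp (- exp (real n * (r - s)))) \<longlonglongrightarrow> 0" by real_asymp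
        with False that show ?thesis by (intro tendsto_scaleR tendsto_const) simp_all
      qed
      have "AE s in lborel. s \<noteq> r" by (rule AE_lborel_singleton)
      then show "AE s in ?M. (\<lambda>n. (1 - exp (- exp (real n * (r - s)))) *\<^sub>R u s) \<longlonglongrightarrow> indicator {..r} s *\<^sub>R u s"
        by (subst AE_restrict_space_iff) (auto intro: lim)
      \<comment> \<open>The kernel lies between 0 and 1.\<close>
      show "AE s in ?M. norm ((1 - exp (- exp (real n * (r - s)))) *\<^sub>R u s) \<le> norm (u s)" for n
        by (intro AE_I2) (auto intro!: mult_left_le_one_le)
    qed
    moreover have "?I \<longlonglongrightarrow> 0"
    proof (rule Lim_null_comparison)
      show "\<forall>\<^sub>F n in sequentially. norm (?I n) \<le> K * (exp (exp (- real n * (T - r))) - 1)"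
        using eventually_gt_at_top[of "0::nat"]
        by eventually_elim (rule phragmen_bound[OF u], use T r K in auto)
      \<comment> \<open>Here \<open>r < T\<close> is essential: the inner exponential then tends to
        0 and the bound tends to \<open>K * (exp 0 - 1) = 0\<close>.\<close>
      have "0 < T - r" using r by simp
      then have "(\<lambda>n. exp (exp (- real n * (T - r))) - 1) \<longlonglongrightarrow> 0" by real_asymp
      then show "(\<lambda>n. K * (exp (exp (- real n * (T - r))) - 1)) \<longlonglongrightarrow> 0"
        by (rule tendsto_mult_right_zero)
    qed
    ultimately have "(LINT s|?M. indicator {..r} s *\<^sub>R u s) = 0"
      by (rule LIMSEQ_unique)
    moreover have "(LINT s|?M. indicator {..r} s *\<^sub>R u s) = (LINT s:{0..r}|lborel. u s)"
      unfolding set_lebesgue_integral_def using r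
      by (subst integral_restrict_space) (auto intro!: Bochner_Integration.integral_cong simp: indicator_def)
    moreover have "(LINT s:{0..r}|lborel. u s) = integral {0..r} u"
      using r by (intro set_borel_integral_eq_integral_continuous continuous_on_subset[OF u]) auto
    ultimately show ?thesis by simp
  qed
  have inner_zero: "u r = 0" if r: "r \<in> {0<..<T}" for r
  proof -
    have "((\<lambda>x. integral {0..x} u) has_vector_derivative u r) (at r within {0..T})"
      using r by (intro integral_has_vector_derivative u) auto
    then have "((\<lambda>x. integral {0..x} u) has_vector_derivative u r) (at r)"
      using r by (simp add: at_within_Icc_at)
    then have "((\<lambda>x. 0) has_vector_derivative u r) (at r)"
      by (rule has_vector_derivative_transform_within_open[where S = "{0<..<T}"])
        (use r zero in auto)
    then show ?thesis
      by (metis has_vector_derivative_const vector_derivative_unique_at)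
  qed
  \<comment> \<open>Continuity carries the vanishing of \<open>u\<close> to both endpoints.\<close>
  have "closure {0<..<T} = {0..T}" using T by simp
  then show ?thesis
    using continuous_constant_on_closure[of "{0<..<T}" u 0 t] u inner_zero t by auto
qed

section \<open>Resolvents on the negative half-line\<close>

text \<open>Negative reals have argument pi, which exceeds the opening angle, so they lie in the
  resolvent set and satisfy the resolvent bound. The constant \<open>C\<close> is the same for all
  \<open>l\<close>; only \<open>J\<close> depends on \<open>l\<close>.\<close>

lemma sectorial_resolvent_neg:
  fixes A :: "'e::complex_banach \<Rightarrow> 'e"
  assumes "sectorial D A"
  obtains C where "\<And>l. 0 < l \<Longrightarrow> \<exists>J. bounded_linear J \<and>
    (\<forall>x\<in>D. J (- l *\<^sub>R x - A x) = x) \<and> (\<forall>y. norm (J y) \<le> C / l * norm y)"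
proof -
  from assms obtain \<theta> C where \<theta>: "0 < \<theta>" "\<theta> < pi / 2" and spec: "spectrum D A \<subseteq> sector \<theta>"
    and bd: "\<And>z. z \<notin> sector \<theta> \<Longrightarrow> z \<noteq> 0 \<Longrightarrow> onorm (resolvent D A z) \<le> C / cmod z"
    unfolding sectorial_def by blast
  have "\<exists>J. bounded_linear J \<and>
    (\<forall>x\<in>D. J (- l *\<^sub>R x - A x) = x) \<and> (\<forall>y. norm (J y) \<le> C / l * norm y)" if l: "0 < l" for l
  proof -
    let ?z = "complex_of_real (- l)"
    let ?J = "resolvent D A ?z"
    have "Arg ?z = pi" using l by (subst Arg_of_real) auto
    then have z: "?z \<notin> sector \<theta>" using \<theta> by (auto simp: sector_def)
    with spec have "?z \<in> resolvent_set D A" by (auto simp: spectrum_def)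
    then have bij: "bij_betw (\<lambda>x. ?z *\<^sub>C x - A x) D UNIV" and bl: "bounded_linear ?J"
      by (auto simp: resolvent_set_def)
    have "?J (?z *\<^sub>C x - A x) = x" if "x \<in> D" for x
      unfolding resolvent_def
      using inv_into_f_f[OF bij_betw_imp_inj_on[OF bij] that] by simp
    then have "\<forall>x\<in>D. ?J (- l *\<^sub>R x - A x) = x"
      unfolding scaleC_complex_of_real by simp
    moreover have "norm (?J y) \<le> C / l * norm y" for y
      using onorm[OF bl, of y] mult_right_mono[OF bd[OF z], of "norm y"] l by simp
    ultimately show ?thesis using bl by blast
  qed
  then show thesis by (rule that)
qed

lemma linear_operator_on_diff:
  fixes A :: "'e::complex_banach \<Rightarrow> 'e"
  assumes "linear_operator_on D A" "x \<in> D" "y \<in> D"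
  shows "x - y \<in> D" "A (x - y) = A x - A y"
proof -
  have m: "(-1) *\<^sub>C v = - v" for v :: 'e
    using scaleC_complex_of_real[of "-1" v] by simp
  have "- y \<in> D" "A (- y) = - A y"
    using assms unfolding linear_operator_on_def by (metis m)+
  then show "x - y \<in> D" "A (x - y) = A x - A y"
    using assms unfolding linear_operator_on_def by (metis diff_conv_add_uminus)+
qed

section \<open>The homogeneous Cauchy problem\<close>

text \<open>Here \<open>a\<close> stands for \<open>A\<close> along \<open>u\<close> and
  \<open>J\<close> for the resolvent at \<open>- l\<close>. Applying \<open>J\<close> replaces the
  merely integrable \<open>- a\<close> by the continuous \<open>b\<close>, so \<open>J u\<close> is
  continuously differentiable and the classical integrating factor \<open>exp (l * (T - s))\<close>
  is available.\<close>

lemma resolvent_variation_of_constants: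
  fixes u :: "real \<Rightarrow> 'e::{banach,second_countable_topology}"
  assumes T: "0 < T" and J: "bounded_linear J"
    and u: "continuous_on {0..T} u"
    and Ja: "\<And>s. s \<in> {0<..T} \<Longrightarrow> J (- l *\<^sub>R u s - a s) = u s"
    and a: "set_integrable lborel {0..T} a"
    and eq: "\<And>t. t \<in> {0<..T} \<Longrightarrow> u t = - (LINT s:{0..t}|lborel. a s)"
  shows "J (u T) = integral {0..T} (\<lambda>s. exp (l * (T - s)) *\<^sub>R u s)"
proof -
  interpret J: bounded_linear J by (rule J)
  define b where "b = (\<lambda>s. l *\<^sub>R J (u s) + u s)"
  have Ja': "J (- a s) = b s" if "s \<in> {0<..T}" for s
  proof -
    have "u s = - l *\<^sub>R J (u s) - J (a s)"
      using Ja[OF that] by (simp only: J.diff J.scaleR)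
    moreover have "- z = x + y" if "y = - x - z" for x y z :: 'e
      using that by simp
    ultimately have "- J (a s) = l *\<^sub>R J (u s) + u s"
      unfolding scaleR_minus_left by blast
    then show ?thesis by (simp add: b_def J.neg)
  qed
  have cont_Ju: "continuous_on {0..T} (\<lambda>s. J (u s))"
    by (intro J.continuous_on u)
  then have cont_b: "continuous_on {0..T} b"
    unfolding b_def by (intro continuous_intros u)
  have Ju_pos: "J (u t) = integral {0..t} b" if t: "t \<in> {0<..T}" for t
  proof -
    have cont_bt: "continuous_on {0..t} b"
      using cont_b by (rule continuous_on_subset) (use t in auto)
    have at: "integrable lborel (\<lambda>s. indicator {0..t} s *\<^sub>R a s)"
      using set_integrable_subset[OF a, of "{0..t}"] t by (simp add: set_integrable_def)
    have "J (u t) = (LINT s|lborel. J (- (indicator {0..t} s *\<^sub>R a s)))"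
      unfolding eq[OF t] set_lebesgue_integral_def integral_minus[symmetric]
      using at by (intro integral_bounded_linear[symmetric] J) simp
    also have "\<dots> = (LINT s:{0..t}|lborel. b s)"
      unfolding set_lebesgue_integral_def
    proof (rule integral_cong_AE)
      show "(\<lambda>s. J (- (indicator {0..t} s *\<^sub>R a s))) \<in> borel_measurable lborel"
        using at by (intro borel_measurable_integrable integrable_bounded_linear[OF J]) simp
      show "(\<lambda>s. indicator {0..t} s *\<^sub>R b s) \<in> borel_measurable lborel"
        using borel_integrable_atLeastAtMost'[OF cont_bt]
        by (auto simp: set_integrable_def)
      \<comment> \<open>The relation between \<open>a\<close> and \<open>b\<close> is known only for
        positive times; the point 0 is a null set.\<close>
      show "AE s in lborel. J (- (indicator {0..t} s *\<^sub>R a s)) = indicator {0..t} s *\<^sub>R b s"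
        using AE_lborel_singleton[of 0]
        by eventually_elim (use t in \<open>auto simp: indicator_def J.zero Ja'\<close>)
    qed
    also have "\<dots> = integral {0..t} b"
      using t by (intro set_borel_integral_eq_integral_continuous cont_bt) auto
    finally show ?thesis .
  qed
  \<comment> \<open>The equation is assumed for \<open>t > 0\<close> only. Continuity extends its
    image under \<open>J\<close> to \<open>t = 0\<close>, which yields the initial value
    \<open>J (u 0) = 0\<close>.\<close>
  have "continuous_on {0..T} (\<lambda>t. J (u t) - integral {0..t} b)"
    by (intro continuous_intros cont_Ju indefinite_integral_continuous_1
        integrable_continuous_interval cont_b)
  moreover have "closure {0<..T} = {0..T}" using T by simp
  ultimately have Ju: "J (u t) = integral {0..t} b" if "t \<in> {0..T}" for t
    using continuous_constant_on_closure[of "{0<..T}" "\<lambda>t. J (u t) - integral {0..t} b" 0 t]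
      Ju_pos that by simp
  have deriv: "((\<lambda>s. J (u s)) has_vector_derivative b t) (at t within {0..T})" if t: "t \<in> {0..T}" for t
    using integral_has_vector_derivative[OF cont_b t]
    by (rule has_vector_derivative_transform[OF t, rotated]) (simp add: Ju)
  \<comment> \<open>In the product rule the term \<open>l *\<^sub>R J (u t)\<close> of
    \<open>b t\<close> cancels against the derivative of the exponential, leaving only
    \<open>u t\<close>.\<close>
  have "((\<lambda>s. exp (l * (T - s)) *\<^sub>R J (u s)) has_vector_derivative exp (l * (T - t)) *\<^sub>R u t)
      (at t within {0..T})" if t: "t \<in> {0..T}" for t
  proof -
    have "((\<lambda>s. exp (l * (T - s))) has_real_derivative - l * exp (l * (T - t))) (at t within {0..T})"
      by (auto intro!: derivative_eq_intros)
    from has_vector_derivative_scaleR[OF this deriv[OF t]] show ?thesis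
      by (simp add: b_def algebra_simps)
  qed
  then have "((\<lambda>s. exp (l * (T - s)) *\<^sub>R u s) has_integral
      exp (l * (T - T)) *\<^sub>R J (u T) - exp (l * (T - 0)) *\<^sub>R J (u 0)) {0..T}"
    using T by (intro fundamental_theorem_of_calculus) auto
  moreover have "J (u 0) = 0" using Ju[of 0] T by simp
  ultimately show ?thesis by (simp add: integral_unique)
qed

text \<open>The resolvent bound makes the exponential moments of \<open>u\<close> bounded, and
  \<open>phragmen\<close> applies. The integrand \<open>a\<close> has to agree with
  \<open>A (u s)\<close> only for \<open>s > 0\<close>: in the application it is a difference of
  values of \<open>A\<close> along two solutions, which need not lie in \<open>D\<close> at time 0,
  where linearity could not be invoked.\<close>

lemma homogeneous_cauchy_problem_unique:
  fixes A :: "'e::{complex_banach,second_countable_topology} \<Rightarrow> 'e" and u :: "real \<Rightarrow> 'e"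
  assumes sect: "sectorial D A" and T: "0 < T"
    and u: "continuous_on {0..T} u"
    and D: "\<And>s. s \<in> {0<..T} \<Longrightarrow> u s \<in> D"
    and a: "\<And>s. s \<in> {0<..T} \<Longrightarrow> a s = A (u s)" "set_integrable lborel {0..T} a"
    and eq: "\<And>t. t \<in> {0<..T} \<Longrightarrow> u t = - (LINT s:{0..t}|lborel. a s)"
    and t: "t \<in> {0..T}"
  shows "u t = 0"
proof -
  obtain C where C: "\<And>l. 0 < l \<Longrightarrow> \<exists>J. bounded_linear J \<and>
    (\<forall>x\<in>D. J (- l *\<^sub>R x - A x) = x) \<and> (\<forall>y. norm (J y) \<le> C / l * norm y)"
    using sectorial_resolvent_neg[OF sect] by blast
  have "norm (integral {0..T} (\<lambda>s. exp (real m * (T - s)) *\<^sub>R u s)) \<le> \<bar>C\<bar> * norm (u T)"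
    if m: "0 < m" for m :: nat
  proof -
    obtain J where J: "bounded_linear J" "\<And>x. x \<in> D \<Longrightarrow> J (- real m *\<^sub>R x - A x) = x"
      "norm (J (u T)) \<le> C / m * norm (u T)"
      using C[of "real m"] m by auto
    have "J (- real m *\<^sub>R u s - a s) = u s" if "s \<in> {0<..T}" for s
      unfolding a(1)[OF that] using that by (intro J(2) D)
    then have "J (u T) = integral {0..T} (\<lambda>s. exp (real m * (T - s)) *\<^sub>R u s)"
      by (rule resolvent_variation_of_constants[OF T J(1) u _ a(2) eq])
    \<comment> \<open>Since \<open>m \<ge> 1\<close>, the bound \<open>C / m\<close> may be replaced
      by a constant; the absolute value avoids any question about the sign of
      \<open>C\<close>.\<close>
    moreover have "C / m \<le> \<bar>C\<bar> / 1"
      using m by (intro frac_le) auto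
    then have "C / m * norm (u T) \<le> \<bar>C\<bar> * norm (u T)"
      by (intro mult_right_mono) auto
    ultimately show ?thesis using J(3) by simp
  qed
  then show ?thesis
    by (rule phragmen[OF T u _ t]) simp
qed

section \<open>From paths to indistinguishability\<close>

text \<open>An almost sure statement only places the exceptional set inside a null set; completeness
  makes that set measurable. This matters because \<open>measure\<close> returns 0 on non-measurable
  sets, and the event of equality at all times is an uncountable intersection.\<close>

lemma (in prob_space) complete_prob_eq_1:
  assumes "complete_measure M" "AE \<omega> in M. P \<omega>"
  shows "measure M {\<omega> \<in> space M. P \<omega>} = 1"
proof -
  interpret complete_measure M by fact
  have "{\<omega> \<in> space M. \<not> P \<omega>} \<in> sets M"
    using assms(2) AE_iff_null_sets by blast
  then have "{\<omega> \<in> space M. P \<omega>} \<in> sets M"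
    by (rule sets.sets_Collect_neg[where P = "\<lambda>\<omega>. \<not> P \<omega>", simplified])
  with assms(2) show ?thesis by (simp add: prob_Collect_eq_1)
qed

theorem theorem3p2:
  fixes M :: "'w measure"
    and \<F> :: "real \<Rightarrow> 'w measure"
    and W :: "real \<Rightarrow> 'h::{real_inner,complete_space,second_countable_topology} \<Rightarrow> 'w \<Rightarrow> real"
    and T :: real
    and D :: "'e::{complex_banach,second_countable_topology} set"
    and A :: "'e \<Rightarrow> 'e"
    and F1 :: "real \<Rightarrow> 'w \<Rightarrow> 'e"
    and G :: "real \<Rightarrow> 'w \<Rightarrow> ('h \<Rightarrow>\<^sub>L 'e)"
    and \<xi> :: "'w \<Rightarrow> 'e"
    and X :: "real \<Rightarrow> 'w \<Rightarrow> 'e"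
  assumes "M_type_2 TYPE('e)"
    and "linear_operator_on D A"
    and "densely_defined D"
    and "closed_operator D A"
    and "sectorial D A"
    and "complete_filtered_prob_space M \<F>"
    and "cylindrical_Wiener_process M \<F> W"
    and "0 < T"
    and "(\<lambda>(t, \<omega>). F1 t \<omega>) \<in> borel_measurable (predictable_sigma M \<F> T)"
    and "I2_process M \<F> T G"
    and "\<xi> \<in> borel_measurable (\<F> 0)"
    and "strict_solution M \<F> W T D A F1 G \<xi> X"
  shows "\<forall>Y. strict_solution M \<F> W T D A F1 G \<xi> Y \<longrightarrow> indistinguishable M T X Y"
proof (intro allI impI)
  fix Y
  assume Y: "strict_solution M \<F> W T D A F1 G \<xi> Y"
  note X = \<open>strict_solution M \<F> W T D A F1 G \<xi> X\<close>
  have M: "prob_space M" "complete_measure M"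
    using \<open>complete_filtered_prob_space M \<F>\<close> by (auto simp: complete_filtered_prob_space_def)
  note lin = linear_operator_on_diff[OF \<open>linear_operator_on D A\<close>]
  \<comment> \<open>In each solution a single null set serves all times, so outside the union of
    four null sets the argument is deterministic.\<close>
  have "AE \<omega> in M. \<forall>t\<in>{0..T}. X t \<omega> = Y t \<omega>"
    using X[unfolded strict_solution_def, THEN conjunct2, THEN conjunct1]
      X[unfolded strict_solution_def, THEN conjunct2, THEN conjunct2]
      Y[unfolded strict_solution_def, THEN conjunct2, THEN conjunct1]
      Y[unfolded strict_solution_def, THEN conjunct2, THEN conjunct2]
  proof eventually_elim
    case (elim \<omega>)
    have XD: "X t \<omega> \<in> D" and YD: "Y t \<omega> \<in> D"
      and intX: "set_integrable lborel {0..t} (\<lambda>s. A (X s \<omega>))"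
      and intY: "set_integrable lborel {0..t} (\<lambda>s. A (Y s \<omega>))"
      if "t \<in> {0<..T}" for t
      using bspec[OF elim(2) that] bspec[OF elim(4) that] by blast+
    let ?u = "\<lambda>t. X t \<omega> - Y t \<omega>" and ?a = "\<lambda>s. A (X s \<omega>) - A (Y s \<omega>)"
    have eq: "?u t = - (LINT s:{0..t}|lborel. ?a s)" if t: "t \<in> {0<..T}" for t
    proof -
      \<comment> \<open>Both equations contain the same process
        \<open>stochastic_integral M \<F> W T G\<close>, one fixed choice of version, so it cancels
        exactly, as do \<open>\<xi>\<close> and the integral of \<open>F1\<close>.\<close>
      have cancel: "x - y = - (p - q)" if "x = v - p + f + w" "y = v - q + f + w" for x y v f w p q :: 'e
        using that by simp
      have "?u t = - ((LINT s:{0..t}|lborel. A (X s \<omega>)) - (LINT s:{0..t}|lborel. A (Y s \<omega>)))"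
        using bspec[OF elim(2) t] bspec[OF elim(4) t] by (blast intro: cancel)
      then show ?thesis
        unfolding set_integral_diff(2)[OF intX[OF t] intY[OF t]] .
    qed
    have aint: "set_integrable lborel {0..T} ?a"
      by (intro set_integral_diff intX intY) (use \<open>0 < T\<close> in auto)
    have cont: "continuous_on {0..T} ?u"
      using elim(1,3) by (rule continuous_on_diff)
    have "?u t = 0" if t: "t \<in> {0..T}" for t
      using \<open>sectorial D A\<close> \<open>0 < T\<close> cont lin(1)[OF XD YD] lin(2)[OF XD YD, symmetric] aint eq t
      by (rule homogeneous_cauchy_problem_unique)
    then show ?case by simp
  qed
  then show "indistinguishable M T X Y"
    unfolding indistinguishable_def by (rule prob_space.complete_prob_eq_1[OF M])
qed

end
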